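(* Let $x,y$ be real numbers and $n$ a positive integer. Then $$[x+y]_{n}=\sum_{\kappa=0}^{n}\begin{bmatrix} n\\ \kappa\end{bmatrix}\epsilon_1^{\kappa(y-n+\kappa)}\,\epsilon_2^{(n-\kappa)(x-\kappa)}\,[x]_{\kappa}\,[y]_{n-\kappa}$$ or, equivalently, $$[x+y]_{n}=\sum_{\kappa=0}^{n}\begin{bmatrix} n\\ \kappa\end{bmatrix}\epsilon_1^{(n-\kappa)(x-\kappa)}\,\epsilon_2^{\kappa(y-n+\kappa)}\,[x]_{\kappa}\,[y]_{n-\kappa}.$$ (Both identities hold.)
   Context: Let $0<q<p\le 1$ be real numbers and let $\mathcal{R}$ be a meromorphic function of two variables. For real $u$ the $\mathcal{R}(p,q)$-deformed number is $[u]:=\mathcal{R}(p^u,q^u)$. Standing assumption: there are positive real numbers $\epsilon_1=\Phi_1(p,q)$, $\epsilon_2=\Phi_2(p,q)$ such that for all real $u,v$, $$[u+v]=\epsilon_1^{v}[u]+\epsilon_2^{u}[v],$$ and $[k]\neq0$ for every integer $k\ge1$. Define, for real $u$ and integer $\kappa\ge1$, the deformed factorial of $u$ of order $\kappa$ by $[u]_{\kappa}:=\prod_{v=1}^{\kappa}[u-v+1]$, with $[u]_0:=1$; the factorial $[k]!:=[1][2]\cdots[k]$, $[0]!:=1$; and the deformed binomial coefficient $\begin{bmatrix}u\\ \kappa\end{bmatrix}:=[u]_\kappa/[\kappa]!$ (all with respect to $\mathcal{R}(p,q)$). *)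

theory Defs
  imports "HOL-Complex_Analysis.Complex_Analysis"
begin

text \<open>Only used on open sets: complex Frechet differentiability in two variables.\<close>

definition holomorphic2_on :: "(complex \<times> complex \<Rightarrow> complex) \<Rightarrow> (complex \<times> complex) set \<Rightarrow> bool" where
  "holomorphic2_on f U \<longleftrightarrow>
     (\<forall>z\<in>U. \<exists>a b. (f has_derivative (\<lambda>(s, t). a * s + b * t)) (at z))"

text \<open>\<open>U\<close> is a connected open neighbourhood of \<open>z\<close> inside \<open>D\<close>, and \<open>h\<close> is holomorphic and not
  identically zero on \<open>U\<close>; the zeros of \<open>h\<close> then form a closed nowhere dense subset of \<open>U\<close>.\<close>

definition local_denominator ::
  "(complex \<times> complex) set \<Rightarrow> complex \<times> complex \<Rightarrow> (complex \<times> complex) set \<Rightarrow>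
   (complex \<times> complex \<Rightarrow> complex) \<Rightarrow> bool" where
  "local_denominator D z U h \<longleftrightarrow>
     open U \<and> connected U \<and> z \<in> U \<and> U \<subseteq> D \<and> holomorphic2_on h U \<and> (\<exists>w\<in>U. h w \<noteq> 0)"

definition holomorphic_extension_at ::
  "(complex \<times> complex \<Rightarrow> complex) \<Rightarrow> (complex \<times> complex) set \<Rightarrow> complex \<times> complex \<Rightarrow>
   (complex \<times> complex \<Rightarrow> complex) \<Rightarrow> bool" where
  "holomorphic_extension_at f D z g \<longleftrightarrow>
     (\<exists>U h. local_denominator D z U h \<and> holomorphic2_on g U \<and> (\<forall>w\<in>U. h w \<noteq> 0 \<longrightarrow> f w = g w))"

text \<open>Local quotients of holomorphic functions. The last two conjuncts fix the values of the total
  function \<open>f\<close> on the thin set where such a quotient does not determine them, as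
  \<open>nicely_meromorphic_on\<close> does in one variable: removable singularities are removed, and the value
  at a point of the polar set (including points of indeterminacy) is \<open>0\<close>. Without
  this, \<open>f\<close> could be changed arbitrarily along an analytic curve, and the points
  \<open>(p powr u, q powr u)\<close> may lie on one.\<close>

definition meromorphic2_on :: "(complex \<times> complex \<Rightarrow> complex) \<Rightarrow> (complex \<times> complex) set \<Rightarrow> bool" where
  "meromorphic2_on f D \<longleftrightarrow> open D \<and>
     (\<forall>z\<in>D. \<exists>U g h. local_denominator D z U h \<and> holomorphic2_on g U \<and>
                    (\<forall>w\<in>U. h w \<noteq> 0 \<longrightarrow> f w = g w / h w)) \<and>
     (\<forall>z\<in>D. \<forall>g. holomorphic_extension_at f D z g \<longrightarrow> f z = g z) \<and>
     (\<forall>z\<in>D. (\<nexists>g. holomorphic_extension_at f D z g) \<longrightarrow> f z = 0)"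

definition deformed_number ::
  "(complex \<times> complex \<Rightarrow> complex) \<Rightarrow> real \<Rightarrow> real \<Rightarrow> real \<Rightarrow> complex" where
  "deformed_number R p q u = R (of_real (p powr u), of_real (q powr u))"

definition deformed_falling ::
  "(complex \<times> complex \<Rightarrow> complex) \<Rightarrow> real \<Rightarrow> real \<Rightarrow> real \<Rightarrow> nat \<Rightarrow> complex" where
  "deformed_falling R p q u k = (\<Prod>v=1..k. deformed_number R p q (u - real v + 1))"

definition deformed_fact ::
  "(complex \<times> complex \<Rightarrow> complex) \<Rightarrow> real \<Rightarrow> real \<Rightarrow> nat \<Rightarrow> complex" where
  "deformed_fact R p q k = (\<Prod>j=1..k. deformed_number R p q (real j))"

definition deformed_binomial ::
  "(complex \<times> complex \<Rightarrow> complex) \<Rightarrow> real \<Rightarrow> real \<Rightarrow> real \<Rightarrow> nat \<Rightarrow> complex" where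
  "deformed_binomial R p q u k = deformed_falling R p q u k / deformed_fact R p q k"

end

theory Submission
  imports Defs
begin

text \<open>Induction on \<open>n\<close>: the new factor is split as
  \<open>[x + y - n] = \<epsilon>1 powr (y - n + \<kappa>) [x - \<kappa>] + \<epsilon>2 powr (x - \<kappa>) [y - n + \<kappa>]\<close> in the \<open>\<kappa>\<close>-th summand, and
  the two halves are recombined by the deformed Pascal rule, itself a case of the addition law.
  As \<open>u + v = v + u\<close>, the addition law also holds with \<open>\<epsilon>1\<close> and \<open>\<epsilon>2\<close> exchanged, which turns the first
  identity into the second.\<close>

lemma deformed_falling_0 [simp]: "deformed_falling R p q u 0 = 1"
  by (simp add: deformed_falling_def)

lemma deformed_falling_Suc:
  "deformed_falling R p q u (Suc k) = deformed_falling R p q u k * deformed_number R p q (u - real k)"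
  by (simp add: deformed_falling_def)

text \<open>Peeling off the top factor instead of the bottom one makes
  \<open>deformed_falling R p q u k\<close> a common factor of all three terms of the Pascal
  rule.\<close>

lemma deformed_falling_Suc_shift:
  "deformed_falling R p q (u + 1) (Suc k) = deformed_number R p q (u + 1) * deformed_falling R p q u k"
  by (induction k) (simp_all add: deformed_falling_Suc algebra_simps)

lemma deformed_fact_Suc:
  "deformed_fact R p q (Suc k) = deformed_fact R p q k * deformed_number R p q (real (Suc k))"
  by (simp add: deformed_fact_def)

lemma deformed_binomial_0 [simp]: "deformed_binomial R p q u 0 = 1"
  by (simp add: deformed_binomial_def deformed_fact_def)

text \<open>The bases \<open>a\<close> and \<open>b\<close> stay abstract so that the results can be
  used for the two deformation constants in either order.\<close>

locale deformed_addition =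
  fixes R :: "complex \<times> complex \<Rightarrow> complex" and p q a b :: real
  assumes add: "deformed_number R p q (u + v) =
      of_real (a powr v) * deformed_number R p q u + of_real (b powr u) * deformed_number R p q v"
    and pos: "a > 0" "b > 0"
    and nonzero: "k \<ge> 1 \<Longrightarrow> deformed_number R p q (real k) \<noteq> 0"
begin

text \<open>The addition law at \<open>u = v = 0\<close> reads [0] = [0] + [0].\<close>

lemma deformed_number_zero: "deformed_number R p q 0 = 0"
  using add[of 0 0] pos by simp

lemma deformed_fact_nonzero: "deformed_fact R p q k \<noteq> 0"
  using nonzero by (simp add: deformed_fact_def)

lemma deformed_binomial_eq_0: "deformed_binomial R p q (real n) (Suc n) = 0"
  by (simp add: deformed_binomial_def deformed_falling_Suc deformed_number_zero)

text \<open>Write [u + 1] = [(u - k) + (k + 1)] and multiply by [u]_k / [k + 1]!: the part with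
  [u - k] completes the falling factorial to order k + 1, while in the other part [k + 1]
  cancels.\<close>

lemma deformed_pascal:
  "deformed_binomial R p q (u + 1) (Suc k) =
     of_real (b powr (u - real k)) * deformed_binomial R p q u k
     + of_real (a powr real (Suc k)) * deformed_binomial R p q u (Suc k)"
proof -
  have "deformed_number R p q (u + 1) =
      of_real (a powr real (Suc k)) * deformed_number R p q (u - real k)
      + of_real (b powr (u - real k)) * deformed_number R p q (real (Suc k))"
    using add[of "u - real k" "real (Suc k)"] by (simp add: algebra_simps)
  moreover have "deformed_number R p q (real (Suc k)) \<noteq> 0"
    by (rule nonzero) simp
  ultimately show ?thesis
    using deformed_fact_nonzero[of k]
    unfolding deformed_binomial_def deformed_falling_Suc_shift
    unfolding deformed_falling_Suc deformed_fact_Suc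
    by (simp add: field_simps del: of_nat_Suc)
qed

lemma deformed_vandermonde:
  "deformed_falling R p q (x + y) n =
     (\<Sum>k=0..n. deformed_binomial R p q (real n) k
        * of_real (a powr (real k * (y - real n + real k)))
        * of_real (b powr ((real n - real k) * (x - real k)))
        * deformed_falling R p q x k * deformed_falling R p q y (n - k))"
proof (induction n)
  case 0
  \<comment> \<open>Both exponents vanish; as \<open>0 powr 0 = 0\<close>, positivity is what makes
    the powers 1.\<close>
  show ?case using pos by simp
next
  case (Suc n)
  \<comment> \<open>The summand without its binomial coefficient, so that \<open>split\<close>
    concerns only powers and falling factorials.\<close>
  define w where "w m k = of_real (a powr (real k * (y - real m + real k)))
      * of_real (b powr ((real m - real k) * (x - real k)))
      * deformed_falling R p q x k * deformed_falling R p q y (m - k)" for m k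
  let ?B = "\<lambda>m. deformed_binomial R p q (real m)"
  \<comment> \<open>The factor [x - k] leads to index k + 1 and [y - n + k] stays at index k. The
    surplus powers depend on neither x nor y: they are the weights of \<open>deformed_pascal\<close>
    at \<open>u = real n\<close>, up to the index shift in the second sum.\<close>
  have split: "w n k * deformed_number R p q (x + y - real n) =
      of_real (b powr (real n - real k)) * w (Suc n) (Suc k) + of_real (a powr real k) * w (Suc n) k"
    if "k \<le> n" for k
  proof -
    have num: "deformed_number R p q (x + y - real n) =
        of_real (a powr (y - real n + real k)) * deformed_number R p q (x - real k)
        + of_real (b powr (x - real k)) * deformed_number R p q (y - real n + real k)"
      using add[of "x - real k" "y - real n + real k"] by (simp add: algebra_simps)
    have fy: "deformed_falling R p q y (Suc n - k) =
        deformed_falling R p q y (n - k) * deformed_number R p q (y - real n + real k)"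
      using that by (simp add: Suc_diff_le deformed_falling_Suc of_nat_diff algebra_simps)
    have a1: "a powr (real (Suc k) * (y - real (Suc n) + real (Suc k))) =
        a powr (real k * (y - real n + real k)) * a powr (y - real n + real k)"
      by (simp flip: powr_add add: algebra_simps)
    have b1: "b powr ((real n - real k) * (x - real k)) =
        b powr (real n - real k) * b powr ((real (Suc n) - real (Suc k)) * (x - real (Suc k)))"
      by (simp flip: powr_add add: algebra_simps)
    have a2: "a powr (real k * (y - real n + real k)) =
        a powr real k * a powr (real k * (y - real (Suc n) + real k))"
      by (simp flip: powr_add add: algebra_simps)
    have b2: "b powr ((real (Suc n) - real k) * (x - real k)) =
        b powr ((real n - real k) * (x - real k)) * b powr (x - real k)"
      by (simp flip: powr_add add: algebra_simps)
    have "w n k * (of_real (a powr (y - real n + real k)) * deformed_number R p q (x - real k)) =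
        of_real (b powr (real n - real k)) * w (Suc n) (Suc k)"
      unfolding w_def a1 b1 by (simp add: deformed_falling_Suc del: of_nat_Suc)
    moreover
    have "w n k * (of_real (b powr (x - real k)) * deformed_number R p q (y - real n + real k)) =
        of_real (a powr real k) * w (Suc n) k"
      unfolding w_def a2 b2 fy by (simp del: of_nat_Suc)
    ultimately show ?thesis
      unfolding num by (simp add: distrib_left)
  qed
  have "deformed_falling R p q (x + y) (Suc n) =
      (\<Sum>k=0..n. ?B n k * (w n k * deformed_number R p q (x + y - real n)))"
    by (simp add: deformed_falling_Suc Suc.IH sum_distrib_right w_def mult.assoc)
  also have "\<dots> = (\<Sum>k=0..n. of_real (b powr (real n - real k)) * ?B n k * w (Suc n) (Suc k))
      + (\<Sum>k=0..n. of_real (a powr real k) * ?B n k * w (Suc n) k)"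
    unfolding sum.distrib[symmetric] by (rule sum.cong) (simp_all add: split algebra_simps)
  \<comment> \<open>The added term at k = n + 1 is zero because its coefficient contains [0]; with
    it, the shifted sum again runs over 0..n.\<close>
  also have "(\<Sum>k=0..n. of_real (a powr real k) * ?B n k * w (Suc n) k) =
      (\<Sum>k=0..Suc n. of_real (a powr real k) * ?B n k * w (Suc n) k)"
    by (simp add: deformed_binomial_eq_0)
  also have "\<dots> = w (Suc n) 0
      + (\<Sum>k=0..n. of_real (a powr real (Suc k)) * ?B n (Suc k) * w (Suc n) (Suc k))"
    using pos unfolding sum.atLeast0_atMost_Suc_shift by (simp del: of_nat_Suc)
  also have "(\<Sum>k=0..n. of_real (b powr (real n - real k)) * ?B n k * w (Suc n) (Suc k))
      + (w (Suc n) 0 + (\<Sum>k=0..n. of_real (a powr real (Suc k)) * ?B n (Suc k) * w (Suc n) (Suc k)))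
      = w (Suc n) 0 + (\<Sum>k=0..n. ?B (Suc n) (Suc k) * w (Suc n) (Suc k))"
    using deformed_pascal[of "real n"]
    by (simp add: sum.distrib distrib_right add.commute)
  also have "\<dots> = (\<Sum>k=0..Suc n. ?B (Suc n) k * w (Suc n) k)"
    unfolding sum.atLeast0_atMost_Suc_shift by (simp del: of_nat_Suc)
  finally show ?case
    unfolding w_def by (simp only: mult.assoc)
qed

end

theorem theorem3p9:
  fixes R :: "complex \<times> complex \<Rightarrow> complex"
    and \<Phi>1 \<Phi>2 :: "real \<Rightarrow> real \<Rightarrow> real"
    and p q \<epsilon>1 \<epsilon>2 x y :: real
    and n :: nat
  assumes "0 < q" and "q < p" and "p \<le> 1"
    and "meromorphic2_on R UNIV"
    and "\<epsilon>1 = \<Phi>1 p q" and "\<epsilon>2 = \<Phi>2 p q"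
    and "\<epsilon>1 > 0" and "\<epsilon>2 > 0"
    and "\<And>u v :: real. deformed_number R p q (u + v) =
           of_real (\<epsilon>1 powr v) * deformed_number R p q u +
           of_real (\<epsilon>2 powr u) * deformed_number R p q v"
    and "\<And>k :: nat. k \<ge> 1 \<Longrightarrow> deformed_number R p q (real k) \<noteq> 0"
    and "n \<ge> 1"
  shows "deformed_falling R p q (x + y) n =
           (\<Sum>\<kappa>=0..n. deformed_binomial R p q (real n) \<kappa>
              * of_real (\<epsilon>1 powr (real \<kappa> * (y - real n + real \<kappa>)))
              * of_real (\<epsilon>2 powr ((real n - real \<kappa>) * (x - real \<kappa>)))
              * deformed_falling R p q x \<kappa> * deformed_falling R p q y (n - \<kappa>))
       \<and> deformed_falling R p q (x + y) n =
           (\<Sum>\<kappa>=0..n. deformed_binomial R p q (real n) \<kappa>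
              * of_real (\<epsilon>1 powr ((real n - real \<kappa>) * (x - real \<kappa>)))
              * of_real (\<epsilon>2 powr (real \<kappa> * (y - real n + real \<kappa>)))
              * deformed_falling R p q x \<kappa> * deformed_falling R p q y (n - \<kappa>))"
proof -
  interpret e12: deformed_addition R p q \<epsilon>1 \<epsilon>2
    using assms(7-10) by unfold_locales
  interpret e21: deformed_addition R p q \<epsilon>2 \<epsilon>1
  proof
    show "deformed_number R p q (u + v) = of_real (\<epsilon>2 powr v) * deformed_number R p q u
        + of_real (\<epsilon>1 powr u) * deformed_number R p q v" for u v
      using e12.add[of v u] by (simp add: add.commute)
  qed (use assms(7,8,10) in auto)
  show ?thesis
    \<comment> \<open>Exchanging the bases alone gives the second identity: x and y keep their
      places and the sum is not reversed.\<close>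
    using e12.deformed_vandermonde[of x y n] e21.deformed_vandermonde[of x y n]
    by (simp only: mult_ac)
qed

end
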